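(* Let $n\ge 2$ and let $G\in\mathcal M_n$ be any minimally strong digraph with vertex set $[n]$ and arc set $\mathcal A(G)$. Then every $n$-party single-output correlation $P_{A|S,R,X}$ that agrees with bi-causal order satisfies $$\Pr[\operatorname{win}(G)]\le 1-\frac{1}{2|\mathcal A(G)|}.$$ Moreover, this inequality, regarded as a linear inequality on the vectors $\bm p\in\mathbb R^{2n(n-1)}$ representing correlations, is facet-defining for the polytope $\mathcal P_n^{\text{bi}}\subseteq\mathbb R^{2n(n-1)}$.
   Context: Notation: $[n]=\{0,\dots,n-1\}$; $[n]^2_{\neq}$ is the set of ordered pairs $(s,r)\in[n]\times[n]$ with $s\neq r$; $d:=n(n-1)$. All digraphs are simple (no loops, no repeated arcs). Single-output correlations: conditional probability distributions $P_{A|S,R,X}$ with probabilities $p(a|s,r,x)$, where $a,x\in\{0,1\}$ and $(s,r)\in[n]^2_{\neq}$ ($s$ is the sender, who holds the input bit $x$; $r$ is the receiver, who outputs the bit $a$). Such a correlation is represented by the vector $\bm p=(\bm p^0,\bm p^1)\in\mathbb R^{2d}$ with $\bm p^x=(p(0|s,r,x))_{(s,r)\in[n]^2_{\neq}}\in\mathbb R^d$. Bi-causal order: $P_{A|S,R,X}$ agrees with bi-causal order if and only if its probabilities decompose as $$p(a|s,r,x)=\sum_{\mathcal F:\,s\notin\mathcal F,\,r\in\mathcal F}p(\mathcal F)\,p^{\bot}_{\mathcal F}(a|s,r)+\sum_{\mathcal F:\,r\in\mathcal F\Rightarrow s\in\mathcal F}p(\mathcal F)\,p^{\top}_{\mathcal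 F}(a|s,r,x),$$ where $\mathcal F$ ranges over the non-empty strict subsets of $[n]$, $p(\mathcal F)$ is a probability distribution over such subsets, and $p^{\bot}_{\mathcal F}(\cdot|s,r)$, $p^{\top}_{\mathcal F}(\cdot|s,r,x)$ are conditional probability distributions on $\{0,1\}$. $\mathcal P_n^{\text{bi}}\subseteq\mathbb R^{2d}$ is the set of vectors $\bm p$ representing such correlations (it is a convex polytope). Graphical game: for a digraph $G$ with vertex set $[n]$ and arc set $\mathcal A(G)$, a referee picks an arc $s\to r$ of $G$ and a bit $x$ uniformly at random, announces $s\to r$ to all parties and $x$ to the sender $s$; the parties win, denoted $\operatorname{win}(G)$, if the receiver $r$ outputs $x$. Thus $$\Pr[\operatorname{win}(G)]=\frac{1}{2|\mathcal A(G)|}\sum_{(i\to j)\in\mathcal A(G),\,x\in\{0,1\}}p(x|i,j,x),$$ where $p(1|i,j,x)=1-p(0|i,j,x)$. Minimally strong digraphs: a digraph is strong if for every ordered pair of distinct vertices $(i,j)$ there is a directed path from $i$ to $j$. $\mathcal M_n$ is the set of all strong digraphs $D$ with vertex set $[n]$ such that for every arc $i\to j$ of $D$, the digraph obtained from $D$ by deleting $i\to j$ (keeping all vertices) is not strong. Facet-defining: for a full-dimensional convex polytope $\mathcal P\subseteq\mathbb R^{D}$, a linear inequality $\bm v\cdot\bm x\le c$ is facet-defining if it holds for all $\bm x\in\mathcal P$ and $\dim(\mathcal P\cap\{\bm x\mid\bm v\cdot\bm x=c\})=D-1$. *)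

theory Defs
  imports
    "HOL-Analysis.Analysis"
    "HOL-Probability.Probability_Mass_Function"
    "HOL-Library.Numeral_Type"
    "Graph_Theory.Graph_Theory"
begin

text \<open>
  The \<open>n\<close> parties are the elements of an arbitrary finite type \<open>'n\<close> with at least two elements
  (class \<^class>\<open>card2\<close>), so \<open>n = CARD('n)\<close>. Bits are booleans, with \<^term>\<open>False\<close> for 0 and
  \<^term>\<open>True\<close> for 1.
\<close>

typedef 'n link = "{(s, r). s \<noteq> r} :: ('n::card2 \<times> 'n) set"
proof -
  have "\<not> CARD('n) \<le> Suc 0"
    using two_le_card[where 'a = 'n] by simp
  then show ?thesis
    by (auto simp: card_le_Suc0_iff_eq)
qed

definition sender :: "'n::card2 link \<Rightarrow> 'n" where
  "sender e = fst (Rep_link e)"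

definition receiver :: "'n::card2 link \<Rightarrow> 'n" where
  "receiver e = snd (Rep_link e)"

lemma card_off_diagonal:
  "card ({(s, r). s \<noteq> r} :: ('n::finite \<times> 'n) set) = CARD('n) * (CARD('n) - 1)"
proof -
  have "{(s, r). s \<noteq> r} = (SIGMA s:(UNIV :: 'n set). UNIV - {s})"
    by auto
  then show ?thesis
    by (simp add: card_Diff_singleton)
qed

instance link :: (card2) finite
proof
  have "(UNIV :: 'a link set) = Abs_link ` {(s, r). s \<noteq> r}"
    by (metis type_definition.Abs_image type_definition_link)
  then show "finite (UNIV :: 'a link set)"
    by (metis finite finite_imageI)
qed

lemma CARD_link: "CARD('n::card2 link) = CARD('n) * (CARD('n) - 1)"
  using type_definition.card[OF type_definition_link] card_off_diagonal
  by metis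

text \<open>
  \<open>P s r x\<close> is the distribution of the output bit of \<open>r\<close> given the input bit \<open>x\<close> of \<open>s\<close>. The
  values on the diagonal \<open>s = r\<close> are meaningless and never used.
\<close>

type_synonym 'n correlation = "'n \<Rightarrow> 'n \<Rightarrow> bool \<Rightarrow> bool pmf"

text \<open>The space of the vectors \<open>(p\<^sup>0, p\<^sup>1)\<close>, where \<open>p\<^sup>0\<close> and \<open>p\<^sup>1\<close> are indexed by the links.\<close>

type_synonym 'n corr_space = "(real ^ 'n link) \<times> (real ^ 'n link)"

lemma DIM_corr_space: "DIM('n::card2 corr_space) = 2 * (CARD('n) * (CARD('n) - 1))"
  by (simp add: CARD_link)

definition corr_vec :: "'n::card2 correlation \<Rightarrow> 'n corr_space" where
  "corr_vec P =
     (\<chi> e. pmf (P (sender e) (receiver e) False) False,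
      \<chi> e. pmf (P (sender e) (receiver e) True) False)"

definition agrees_with_bicausal_order :: "'n::card2 correlation \<Rightarrow> bool" where
  "agrees_with_bicausal_order P \<longleftrightarrow>
     (\<exists>(q :: 'n set pmf)
       (pbot :: 'n set \<Rightarrow> 'n \<Rightarrow> 'n \<Rightarrow> bool pmf)
       (ptop :: 'n set \<Rightarrow> 'n \<Rightarrow> 'n \<Rightarrow> bool \<Rightarrow> bool pmf).
       set_pmf q \<subseteq> {F. F \<noteq> {} \<and> F \<noteq> UNIV} \<and>
       (\<forall>s r x a. s \<noteq> r \<longrightarrow>
          pmf (P s r x) a =
            (\<Sum>F | F \<noteq> {} \<and> F \<noteq> UNIV \<and> s \<notin> F \<and> r \<in> F.
               pmf q F * pmf (pbot F s r) a) +
            (\<Sum>F | F \<noteq> {} \<and> F \<noteq> UNIV \<and> (r \<in> F \<longrightarrow> s \<in> F).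
               pmf q F * pmf (ptop F s r x) a)))"

definition bicausal_polytope :: "'n::card2 corr_space set" where
  "bicausal_polytope = {corr_vec P | P. agrees_with_bicausal_order P}"

definition win_prob :: "'n pair_pre_digraph \<Rightarrow> 'n correlation \<Rightarrow> real" where
  "win_prob G P =
     1 / (2 * real (card (parcs G))) * (\<Sum>(i, j)\<in>parcs G. \<Sum>x\<in>UNIV. pmf (P i j x) x)"

definition minimally_strong :: "'n pair_pre_digraph \<Rightarrow> bool" where
  "minimally_strong G \<longleftrightarrow>
     pair_digraph G \<and> strongly_connected (with_proj G) \<and>
     (\<forall>e\<in>parcs G. \<not> strongly_connected (pre_digraph.del_arc (with_proj G) e))"

definition facet_defining :: "'a::euclidean_space set \<Rightarrow> 'a \<Rightarrow> real \<Rightarrow> bool" where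
  "facet_defining S v c \<longleftrightarrow>
     polytope S \<and> aff_dim S = int DIM('a) \<and>
     (\<forall>x\<in>S. v \<bullet> x \<le> c) \<and>
     aff_dim (S \<inter> {x. v \<bullet> x = c}) = int DIM('a) - 1"

end

theory Submission
  imports Defs
begin

text \<open>
  The polytope is the convex hull of the cells of the proper nonempty sets \<open>F\<close>, the cubes cut
  out by \<open>p\<^sup>0 e = p\<^sup>1 e\<close> for the links \<open>e\<close> entering \<open>F\<close>. In a strong digraph some arc enters \<open>F\<close>,
  and on that arc the two winning probabilities add up to 1: this gives the bound. If \<open>G\<close> is
  minimally strong then every arc \<open>e\<close> is the only arc entering some set \<open>F e\<close>. The cell of \<open>F e\<close>
  contains tight points in which \<open>p\<^sup>0 e = p\<^sup>1 e\<close> is arbitrary, hence a linear functional that is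
  constant on the tight points has opposite coefficients on \<open>p\<^sup>0 e\<close> and \<open>p\<^sup>1 e\<close>, and comparing
  different arcs shows that these do not depend on \<open>e\<close>. If \<open>s \<rightarrow> r\<close> is not an arc, it does not
  enter \<open>F e\<close> for an arc \<open>e\<close> leaving \<open>r\<close>, so the functional vanishes on both of its coordinates.
\<close>

section \<open>Facets and polytopes in a Euclidean space\<close>

text \<open>The differences of tight points from \<open>b\<close> lie in the hyperplane orthogonal
  to \<open>v\<close>. If they spanned less, some nonzero \<open>y\<close> of that hyperplane would
  be orthogonal to all of them, which \<open>orth\<close> excludes. The single non-tight point
  \<open>p\<close> yields full dimension of \<open>S\<close>, so that this needs no proof of its
  own.\<close>

lemma facet_definingI:
  fixes S :: "'a::euclidean_space set"
  assumes "polytope S" and le: "\<And>x. x \<in> S \<Longrightarrow> v \<bullet> x \<le> c"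
    and p: "p \<in> S" "v \<bullet> p < c" and b: "b \<in> S" "v \<bullet> b = c"
    and orth: "\<And>y. v \<bullet> y = 0 \<Longrightarrow> (\<And>x. x \<in> S \<Longrightarrow> v \<bullet> x = c \<Longrightarrow> y \<bullet> x = y \<bullet> b) \<Longrightarrow> y = 0"
  shows "facet_defining S v c"
proof -
  let ?T = "S \<inter> {x. v \<bullet> x = c}"
  let ?D = "(+) (- b) ` ?T"
  have "v \<noteq> 0" using p b by auto
  have sub: "subspace {y. v \<bullet> y = 0}" by (simp add: subspace_hyperplane)
  have sp: "span {y. v \<bullet> y = 0} = {y. v \<bullet> y = 0}"
    using sub by (simp only: span_eq_iff)
  have incl: "span ?D \<subseteq> {y. v \<bullet> y = 0}"
    by (rule span_minimal[OF _ sub]) (auto simp: inner_simps b)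
  have "span ?D = {y. v \<bullet> y = 0}"
  proof (rule ccontr)
    assume "span ?D \<noteq> {y. v \<bullet> y = 0}"
    then have "span ?D \<subset> span {y. v \<bullet> y = 0}"
      unfolding sp using incl by (rule psubsetI[rotated])
    then obtain y where y: "y \<noteq> 0" "y \<in> span {y. v \<bullet> y = 0}"
      and yD: "\<And>z. z \<in> span ?D \<Longrightarrow> orthogonal y z"
      by (metis orthogonal_to_subspace_exists_gen)
    have "v \<bullet> y = 0" using y(2) unfolding sp by simp
    moreover have "y \<bullet> x = y \<bullet> b" if "x \<in> S" "v \<bullet> x = c" for x
    proof -
      have "- b + x \<in> span ?D" using that by (intro span_base) auto
      from yD[OF this] show ?thesis by (simp add: orthogonal_def inner_simps)
    qed
    ultimately show False using orth y(1) by blast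
  qed
  then have "dim ?D = DIM('a) - 1"
    by (metis dim_span dim_hyperplane \<open>v \<noteq> 0\<close>)
  moreover have "aff_dim ?T = int (dim ?D)"
    by (rule aff_dim_eq_dim) (use b in \<open>auto intro: hull_inc\<close>)
  ultimately have T: "aff_dim ?T = int DIM('a) - 1"
    using DIM_positive[where 'a='a] by (simp add: of_nat_diff Suc_leI)
  \<comment> \<open>The tight points already have affine dimension one less than the space, so one
    more point of \<open>S\<close> off their affine hull fills the space.\<close>
  have "affine hull ?T \<subseteq> {x. v \<bullet> x = c}"
    by (rule hull_minimal) (auto simp: affine_hyperplane)
  with p have "p \<notin> affine hull ?T" by auto
  moreover have "p \<in> affine hull S" using p by (simp add: hull_inc)
  ultimately have "affine hull ?T \<subset> affine hull S"
    using hull_mono[of ?T S affine] by auto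
  from aff_dim_psubset[OF this] have "aff_dim S = int DIM('a)"
    using T aff_dim_le_DIM[of S] by linarith
  with T assms(1) le show ?thesis unfolding facet_defining_def by blast
qed

lemma facet_defining_scaleR:
  assumes "facet_defining S v c" "t > 0"
  shows "facet_defining S (t *\<^sub>R v) (t * c)"
  using assms by (simp add: facet_defining_def)

lemma polytope_convex_hull_UN:
  assumes "finite I" and "\<And>i. i \<in> I \<Longrightarrow> polytope (S i)"
  shows "polytope (convex hull (\<Union>i\<in>I. S i))"
proof -
  have "\<forall>i\<in>I. \<exists>V. finite V \<and> S i = convex hull V"
    using assms(2) by (auto simp: polytope_def)
  then obtain V where V: "\<And>i. i \<in> I \<Longrightarrow> finite (V i)" "\<And>i. i \<in> I \<Longrightarrow> S i = convex hull (V i)"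
    by metis
  have "convex hull (\<Union>i\<in>I. S i) = convex hull (\<Union>i\<in>I. V i)"
  proof (rule antisym)
    show "convex hull (\<Union>i\<in>I. S i) \<subseteq> convex hull (\<Union>i\<in>I. V i)"
    proof (rule hull_minimal)
      show "(\<Union>i\<in>I. S i) \<subseteq> convex hull (\<Union>i\<in>I. V i)"
        by (simp add: V(2) UN_least UN_upper hull_mono)
    qed (rule convex_convex_hull)
    show "convex hull (\<Union>i\<in>I. V i) \<subseteq> convex hull (\<Union>i\<in>I. S i)"
      by (intro hull_mono UN_mono) (simp_all add: V(2) hull_subset)
  qed
  then show ?thesis
    using V(1) assms(1) by (metis finite_UN polytope_convex_hull)
qed

section \<open>The bi-causal polytope as a convex hull of cells\<close>

lemma sender_neq_receiver: "sender e \<noteq> receiver e"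
  using Rep_link[of e] by (auto simp: sender_def receiver_def)

lemma Rep_link_eq: "Rep_link e = (sender e, receiver e)"
  by (simp add: sender_def receiver_def)

definition enters :: "'n::card2 link \<Rightarrow> 'n set \<Rightarrow> bool" where
  "enters e F \<longleftrightarrow> sender e \<notin> F \<and> receiver e \<in> F"

definition cell :: "'n::card2 set \<Rightarrow> 'n corr_space set" where
  "cell F = {w. (\<forall>e. fst w $ e \<in> {0..1} \<and> snd w $ e \<in> {0..1}) \<and>
     (\<forall>e. enters e F \<longrightarrow> fst w $ e = snd w $ e)}"

definition proper_subsets :: "'n set set" where
  "proper_subsets = {F. F \<noteq> {} \<and> F \<noteq> UNIV}"

text \<open>Needs two parties. A link enters this set exactly if its sender is \<open>r\<close>, so
  the cut condition for it produces an arc leaving \<open>r\<close>.\<close>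

lemma Compl_singleton_in_proper_subsets: "- {r :: 'n::card2} \<in> proper_subsets"
proof -
  have "card (- {r}) \<noteq> 0"
    using two_le_card[where 'a='n] by (simp add: Compl_eq_Diff_UNIV card_Diff_singleton)
  then have "- {r} \<noteq> {}" by (metis card.empty)
  then show ?thesis by (auto simp: proper_subsets_def)
qed

text \<open>A cell is the image of the unit cube under the linear map that overwrites the second
  coordinate by the first on the links entering \<open>F\<close>; this map fixes the cell
  pointwise.\<close>

lemma polytope_cell: "polytope (cell F)"
proof -
  let ?L = "\<lambda>w::'a corr_space. (fst w, \<chi> e. if enters e F then fst w $ e else snd w $ e)"
  let ?B = "cbox (0, 0) (\<chi> e. 1, \<chi> e. 1) :: 'a corr_space set"
  have "linear ?L"
    by (rule linearI) (auto simp: vec_eq_iff)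
  moreover have "cell F = ?L ` ?B"
  proof (intro equalityI subsetI)
    fix w assume w: "w \<in> cell F"
    then have "w = ?L w" by (auto simp: cell_def prod_eq_iff vec_eq_iff)
    moreover have "w \<in> ?B"
      using w by (cases w) (auto simp: cell_def mem_box_cart)
    ultimately show "w \<in> ?L ` ?B" by (rule image_eqI)
  qed (auto simp: cell_def mem_box_cart)
  ultimately show ?thesis
    by (simp only: polytope_linear_image polytope_interval)
qed

lemma zero_in_cell: "0 \<in> cell F"
  by (simp add: cell_def)

text \<open>The coordinates of \<^const>\<open>corr_vec\<close> are probabilities of \<^term>\<open>False\<close>, hence \<open>1 - t\<close>.\<close>

definition unit_pmf :: "real \<Rightarrow> bool pmf" where
  "unit_pmf t = bernoulli_pmf (1 - t)"

lemma pmf_unit_pmf: "t \<in> {0..1} \<Longrightarrow> pmf (unit_pmf t) a = (if a then 1 - t else t)"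
  by (auto simp: unit_pmf_def)

lemma pmf_bool_True: "pmf p True = 1 - pmf p False"
proof -
  have "pmf p True + pmf p False = 1"
    using sum_pmf_eq_1[OF finite subset_UNIV, of p] by (simp add: UNIV_bool)
  then show ?thesis by simp
qed

text \<open>The distribution of \<open>F\<close> supplies the convex coefficients, and the
  conditional distributions attached to one \<open>F\<close> amount to an arbitrary point of
  \<open>cell F\<close>.\<close>

lemma bicausal_polytope_eq:
  "(bicausal_polytope :: 'a::card2 corr_space set) = convex hull (\<Union>F\<in>proper_subsets. cell F)" (is "_ = ?R")
proof -
  have R: "?R = {\<Sum>F\<in>proper_subsets. c F *\<^sub>R w F | c w. (\<forall>F\<in>proper_subsets. c F \<ge> 0)
      \<and> sum c proper_subsets = 1 \<and> (\<forall>F\<in>proper_subsets. w F \<in> cell F)}"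
    using zero_in_cell
    by (intro convex_hull_finite_union) (auto intro: polytope_imp_convex polytope_cell)
  \<comment> \<open>The two index sets of the bi-causal decomposition partition the proper nonempty
    sets, so its two sums merge into one.\<close>
  have split: "(\<Sum>F | F \<noteq> {} \<and> F \<noteq> UNIV \<and> s \<notin> F \<and> r \<in> F. f F) +
      (\<Sum>F | F \<noteq> {} \<and> F \<noteq> UNIV \<and> (r \<in> F \<longrightarrow> s \<in> F). g F) =
      (\<Sum>F\<in>proper_subsets. if s \<notin> F \<and> r \<in> F then f F else g F)"
    for s r :: 'a and f g :: "'a set \<Rightarrow> real"
  proof -
    have "(\<Sum>F\<in>proper_subsets. if s \<notin> F \<and> r \<in> F then f F else g F) =
       sum f (proper_subsets \<inter> {F. s \<notin> F \<and> r \<in> F}) + sum g (proper_subsets \<inter> - {F. s \<notin> F \<and> r \<in> F})"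
      by (rule sum.If_cases) simp
    moreover have "proper_subsets \<inter> {F. s \<notin> F \<and> r \<in> F} = {F. F \<noteq> {} \<and> F \<noteq> UNIV \<and> s \<notin> F \<and> r \<in> F}"
      "proper_subsets \<inter> - {F. s \<notin> F \<and> r \<in> F} = {F. F \<noteq> {} \<and> F \<noteq> UNIV \<and> (r \<in> F \<longrightarrow> s \<in> F)}"
      by (auto simp: proper_subsets_def)
    ultimately show ?thesis by simp
  qed
  show ?thesis
  proof (intro equalityI subsetI)
    fix u :: "'a corr_space" assume "u \<in> bicausal_polytope"
    then obtain P :: "'a correlation" where u: "u = corr_vec P" and P: "agrees_with_bicausal_order P"
      by (auto simp: bicausal_polytope_def)
    from P[unfolded agrees_with_bicausal_order_def split proper_subsets_def[symmetric]]
    obtain q :: "'a set pmf" and pbot ptop where q: "set_pmf q \<subseteq> proper_subsets"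
      and "\<forall>s r x a. s \<noteq> r \<longrightarrow> pmf (P s r x) a =
         (\<Sum>F\<in>proper_subsets. if s \<notin> F \<and> r \<in> F then pmf q F * pmf (pbot F s r) a
            else pmf q F * pmf (ptop F s r x) a)"
      by (elim exE conjE) (rule that)
    note P = this(2)[rule_format]
    define w where "w F = ((\<chi> e. if enters e F then pmf (pbot F (sender e) (receiver e)) False
         else pmf (ptop F (sender e) (receiver e) False) False,
       \<chi> e. if enters e F then pmf (pbot F (sender e) (receiver e)) False
         else pmf (ptop F (sender e) (receiver e) True) False) :: 'a corr_space)" for F
    have "u = (\<Sum>F\<in>proper_subsets. pmf q F *\<^sub>R w F)"
      unfolding u corr_vec_def w_def
      by (auto simp: prod_eq_iff vec_eq_iff fst_sum snd_sum P sender_neq_receiver enters_def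
          intro!: sum.cong)
    moreover have "sum (pmf q) proper_subsets = 1"
      using q by (intro sum_pmf_eq_1) auto
    moreover have "w F \<in> cell F" for F
      by (auto simp: cell_def w_def pmf_le_1)
    ultimately show "u \<in> ?R" unfolding R by fastforce
  next
    fix u :: "'a corr_space" assume "u \<in> ?R"
    then obtain c w where u: "u = (\<Sum>F\<in>proper_subsets. c F *\<^sub>R w F)"
      and c: "\<And>F. F \<in> proper_subsets \<Longrightarrow> c F \<ge> 0" "sum c proper_subsets = 1"
      and w: "\<And>F. F \<in> proper_subsets \<Longrightarrow> w F \<in> cell F"
      unfolding R by blast
    \<comment> \<open>The coefficients are controlled only on proper nonempty sets; extended by 0
      they form a probability mass function on all sets.\<close>
    define c' where "c' F = (if F \<in> proper_subsets then c F else 0)" for F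
    have nonneg: "c' F \<ge> 0" for F using c by (simp add: c'_def)
    have "(\<integral>\<^sup>+F. ennreal (c' F) \<partial>count_space UNIV) = ennreal (\<Sum>F\<in>UNIV. c' F)"
      by (simp add: nn_integral_count_space_finite sum_ennreal nonneg)
    also have "(\<Sum>F\<in>UNIV. c' F) = 1"
      using c(2) by (simp add: c'_def sum.If_cases)
    finally have one: "(\<integral>\<^sup>+F. ennreal (c' F) \<partial>count_space UNIV) = 1" by simp
    define q where "q = embed_pmf c'"
    have q: "pmf q F = c' F" for F
      unfolding q_def by (rule pmf_embed_pmf) (use nonneg one in auto)
    \<comment> \<open>\<open>val x v e\<close> is the probability of output \<open>False\<close> on
      input \<open>x\<close> along the link \<open>e\<close>.\<close>
    define val where "val x v e = (if x then snd v $ e else fst v $ e)"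
      for x and v :: "'a corr_space" and e
    define L where "L s r = (Abs_link (s, r) :: 'a link)" for s r
    have L: "sender (L s r) = s" "receiver (L s r) = r" if "s \<noteq> r" for s r
      using that by (simp_all add: L_def sender_def receiver_def Abs_link_inverse)
    have LR: "L (sender e) (receiver e) = e" for e
      by (metis L_def Rep_link_eq Rep_link_inverse)
    define P where "P s r x = unit_pmf (val x u (L s r))" for s r x
    \<comment> \<open>The choice of input \<open>False\<close> is immaterial: on links entering
      \<open>F\<close> the two coordinates of \<open>w F\<close> agree.\<close>
    define pbot where "pbot F s r = unit_pmf (val False (w F) (L s r))" for F s r
    define ptop where "ptop F s r x = unit_pmf (val x (w F) (L s r))" for F s r x
    have w01: "val x (w F) e \<in> {0..1}" if "F \<in> proper_subsets" for F x e
      using w[OF that] by (simp add: cell_def val_def)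
    have valu: "val x u e = (\<Sum>F\<in>proper_subsets. c F * val x (w F) e)" for x e
      by (simp add: val_def u fst_sum snd_sum)
    have u01: "val x u e \<in> {0..1}" for x e
    proof -
      have "0 \<le> val x u e" unfolding valu using w01 c(1) by (intro sum_nonneg) auto
      moreover have "val x u e \<le> sum c proper_subsets"
        unfolding valu using w01 c(1) by (intro sum_mono) (auto intro: mult_left_le)
      ultimately show ?thesis using c(2) by simp
    qed
    have "pmf (P s r x) a = (\<Sum>F\<in>proper_subsets. if s \<notin> F \<and> r \<in> F then pmf q F * pmf (pbot F s r) a
            else pmf q F * pmf (ptop F s r x) a)" if "s \<noteq> r" for s r x a
    proof -
      have "(\<Sum>F\<in>proper_subsets. if s \<notin> F \<and> r \<in> F then pmf q F * pmf (pbot F s r) a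
            else pmf q F * pmf (ptop F s r x) a) =
         (\<Sum>F\<in>proper_subsets. c F * (if a then 1 - val x (w F) (L s r) else val x (w F) (L s r)))"
      proof (rule sum.cong[OF refl])
        fix F assume F: "F \<in> (proper_subsets :: 'a set set)"
        have "val False (w F) (L s r) = val x (w F) (L s r)" if "s \<notin> F" "r \<in> F"
          using w[OF F] L[OF \<open>s \<noteq> r\<close>] that by (auto simp: cell_def enters_def val_def)
        then show "(if s \<notin> F \<and> r \<in> F then pmf q F * pmf (pbot F s r) a
            else pmf q F * pmf (ptop F s r x) a) =
           c F * (if a then 1 - val x (w F) (L s r) else val x (w F) (L s r))"
          using F by (simp add: pbot_def ptop_def pmf_unit_pmf[OF w01[OF F]] q c'_def)
      qed
      \<comment> \<open>For \<open>a = True\<close> this uses that the coefficients sum to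
        1.\<close>
      also have "\<dots> = (if a then 1 - val x u (L s r) else val x u (L s r))"
        by (simp add: valu c(2) right_diff_distrib sum_subtractf)
      also have "\<dots> = pmf (P s r x) a"
        by (simp add: P_def pmf_unit_pmf[OF u01])
      finally show ?thesis by simp
    qed
    moreover have "set_pmf q \<subseteq> proper_subsets"
      by (auto simp: set_pmf_eq q c'_def split: if_splits)
    ultimately have "agrees_with_bicausal_order P"
      unfolding agrees_with_bicausal_order_def split proper_subsets_def[symmetric] by blast
    moreover have "corr_vec P = u"
      using u01[of False] u01[of True]
      by (simp add: corr_vec_def prod_eq_iff vec_eq_iff P_def LR pmf_unit_pmf val_def)
    ultimately show "u \<in> bicausal_polytope" by (auto simp: bicausal_polytope_def)
  qed
qed

lemma polytope_bicausal_polytope: "polytope bicausal_polytope"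
  unfolding bicausal_polytope_eq by (intro polytope_convex_hull_UN polytope_cell) simp

lemma cell_subset_bicausal_polytope: "F \<in> proper_subsets \<Longrightarrow> cell F \<subseteq> bicausal_polytope"
  unfolding bicausal_polytope_eq by (meson UN_upper hull_subset subset_trans)

section \<open>The game functional on a set of links\<close>

text \<open>The signs arise because the coordinates are probabilities of output 0: input 0 is won
  with probability \<open>fst w $ e\<close>, input 1 with \<open>1 - snd w $ e\<close>. The constant
  1 per link is left to the right-hand side.\<close>

definition game_vec :: "'n::card2 link set \<Rightarrow> 'n corr_space" where
  "game_vec A = (\<chi> e. if e \<in> A then 1 else 0, \<chi> e. if e \<in> A then - 1 else 0)"

lemma inner_game_vec: "game_vec A \<bullet> w = (\<Sum>e\<in>A. fst w $ e - snd w $ e)"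
proof -
  have "game_vec A \<bullet> w =
      (\<Sum>e\<in>UNIV. if e \<in> A then fst w $ e else 0) + (\<Sum>e\<in>UNIV. if e \<in> A then - snd w $ e else 0)"
    unfolding game_vec_def inner_prod_def inner_vec_def
    by (intro arg_cong2[where f = "(+)"] sum.cong) auto
  then show ?thesis
    by (simp add: sum.If_cases sum_subtractf sum_negf)
qed

text \<open>A half-space is convex, so checking each cell suffices. There an entering link of
  \<open>A\<close> contributes 0 and every other link at most 1.\<close>

lemma inner_game_vec_le:
  assumes "\<And>F. F \<in> proper_subsets \<Longrightarrow> \<exists>e\<in>A. enters e F"
    and "w \<in> bicausal_polytope"
  shows "game_vec A \<bullet> w \<le> real (card A) - 1"
proof -
  have "cell F \<subseteq> {w. game_vec A \<bullet> w \<le> real (card A) - 1}" if "F \<in> proper_subsets" for F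
  proof
    fix w assume w: "w \<in> cell F"
    from assms(1)[OF that] obtain e where e: "e \<in> A" "enters e F" by blast
    have "game_vec A \<bullet> w = (fst w $ e - snd w $ e) + (\<Sum>f\<in>A - {e}. fst w $ f - snd w $ f)"
      unfolding inner_game_vec using e by (simp add: sum.remove)
    also have "fst w $ e - snd w $ e = 0" using w e by (simp add: cell_def)
    also have "(\<Sum>f\<in>A - {e}. fst w $ f - snd w $ f) \<le> (\<Sum>f\<in>A - {e}. 1)"
    proof (rule sum_mono)
      fix f
      have "fst w $ f \<le> 1" "0 \<le> snd w $ f" using w by (auto simp: cell_def)
      then show "fst w $ f - snd w $ f \<le> 1" by linarith
    qed
    \<comment> \<open>\<open>e\<close> makes \<open>A\<close> nonempty, so the natural subtraction
      does not truncate.\<close>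
    also have "(\<Sum>f\<in>A - {e}. 1) = real (card A) - 1"
      using e card_gt_0_iff[of A] by (auto simp: card_Diff_singleton of_nat_diff)
    finally show "w \<in> {w. game_vec A \<bullet> w \<le> real (card A) - 1}" by simp
  qed
  then have "bicausal_polytope \<subseteq> {w. game_vec A \<bullet> w \<le> real (card A) - 1}"
    unfolding bicausal_polytope_eq by (intro hull_minimal convex_halfspace_le) blast
  with assms(2) show ?thesis by blast
qed

text \<open>\<open>cut\<close> expresses strength and \<open>crit\<close> minimality, both as
  statements about sets entered by links.\<close>

lemma facet_defining_game_vec:
  fixes A :: "'a::card2 link set"
  assumes cut: "\<And>F. F \<in> proper_subsets \<Longrightarrow> \<exists>e\<in>A. enters e F"
    and crit: "\<And>e. e \<in> A \<Longrightarrow> \<exists>F\<in>proper_subsets. \<forall>f\<in>A. enters f F \<longleftrightarrow> f = e"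
  shows "facet_defining bicausal_polytope (game_vec A) (real (card A) - 1)"
proof -
  obtain F where F: "\<And>e. e \<in> A \<Longrightarrow> F e \<in> proper_subsets"
    "\<And>e f. e \<in> A \<Longrightarrow> f \<in> A \<Longrightarrow> enters f (F e) \<longleftrightarrow> f = e"
    using crit by metis
  have leaving: "\<exists>e\<in>A. sender e = r" for r
    using cut[OF Compl_singleton_in_proper_subsets[of r]] by (auto simp: enters_def)
  then obtain e0 where e0: "e0 \<in> A" by blast
  \<comment> \<open>\<open>base e\<close> wins with certainty on all links of \<open>A\<close> but
    \<open>e\<close>; its coordinates on \<open>e\<close> and outside \<open>A\<close> are
    0.\<close>
  define base where "base e = ((\<chi> f. if f \<in> A - {e} then 1 else 0, 0) :: 'a corr_space)" for e
  have sum_rm: "(\<Sum>f\<in>A. if f \<in> A - {e} then g f else 0) = sum g A - g e"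
    if "e \<in> A" for e and g :: "'a link \<Rightarrow> real"
  proof -
    have "A \<inter> (A - {e}) = A - {e}" by blast
    then show ?thesis using that by (simp only: sum.inter_restrict[symmetric] finite sum_diff1) simp
  qed
  \<comment> \<open>The coordinates outside \<open>A\<close> are restricted by the cell only, and
    the two on \<open>e\<close> need only coincide.\<close>
  have tight: "w \<in> bicausal_polytope \<and> game_vec A \<bullet> w = real (card A) - 1"
    if "e \<in> A" "w \<in> cell (F e)" "\<And>f. f \<in> A - {e} \<Longrightarrow> fst w $ f = 1 \<and> snd w $ f = 0" for e w
  proof
    show "w \<in> bicausal_polytope"
      using cell_subset_bicausal_polytope F(1) that by blast
    have "fst w $ e = snd w $ e" using that(1,2) F(2) by (simp add: cell_def)
    then have "game_vec A \<bullet> w = (\<Sum>f\<in>A. if f \<in> A - {e} then 1 else 0)"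
      unfolding inner_game_vec using that(3) by (intro sum.cong) auto
    then show "game_vec A \<bullet> w = real (card A) - 1"
      using sum_rm[OF that(1), of "\<lambda>_. 1"] by simp
  qed
  have base_cell: "base e \<in> cell (F e)" if "e \<in> A" for e
    using F(2) that by (auto simp: cell_def base_def)
  have base_tight: "f \<in> A - {e} \<Longrightarrow> fst (base e) $ f = 1 \<and> snd (base e) $ f = 0" for e f
    by (simp add: base_def)
  show ?thesis
  proof (rule facet_definingI)
    show "(0 :: 'a corr_space) \<in> bicausal_polytope"
      by (rule subsetD[OF cell_subset_bicausal_polytope[OF F(1)[OF e0]] zero_in_cell])
    \<comment> \<open>Strictness requires two links in \<open>A\<close>: \<open>e0\<close> and one
      leaving the receiver of \<open>e0\<close>.\<close>
    show "game_vec A \<bullet> 0 < real (card A) - 1"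
    proof -
      obtain e1 where "e1 \<in> A" "sender e1 = receiver e0" using leaving by blast
      then have "{e0, e1} \<subseteq> A" "e0 \<noteq> e1" using e0 sender_neq_receiver[of e0] by auto
      then have "2 \<le> card A" using card_mono[of A "{e0, e1}"] by simp
      then show ?thesis by simp
    qed
    show "base e0 \<in> bicausal_polytope" "game_vec A \<bullet> base e0 = real (card A) - 1"
      using tight[OF e0 base_cell[OF e0] base_tight] by blast+
  next
    fix y :: "'a corr_space"
    assume vy: "game_vec A \<bullet> y = 0"
      and "\<And>x. x \<in> bicausal_polytope \<Longrightarrow> game_vec A \<bullet> x = real (card A) - 1 \<Longrightarrow> y \<bullet> x = y \<bullet> base e0"
    then have const: "y \<bullet> w = y \<bullet> base e0"
      if "e \<in> A" "w \<in> cell (F e)" "\<And>f. f \<in> A - {e} \<Longrightarrow> fst w $ f = 1 \<and> snd w $ f = 0" for e w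
      using tight that by blast
    have base0: "y \<bullet> base e = y \<bullet> base e0" if "e \<in> A" for e
      using const[OF that base_cell[OF that] base_tight] .
    \<comment> \<open>Any displacement of \<open>base e\<close> inside the cell that leaves the
      other links of \<open>A\<close> alone joins two tight points, so \<open>y\<close> vanishes on
      it.\<close>
    have move: "y \<bullet> z = 0" if "e \<in> A" "base e + z \<in> cell (F e)"
      "\<And>f. f \<in> A - {e} \<Longrightarrow> fst z $ f = 0 \<and> snd z $ f = 0" for e z
    proof -
      have "y \<bullet> (base e + z) = y \<bullet> base e0"
        by (rule const) (use that base_tight in auto)
      then show ?thesis using base0[OF that(1)] by (simp add: inner_add_right)
    qed
    have on: "snd y $ e = - fst y $ e" if "e \<in> A" for e
    proof -
      have "y \<bullet> (axis e 1, axis e 1) = 0"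
        by (rule move[OF that]) (use that F(2) in \<open>auto simp: cell_def base_def axis_def\<close>)
      then show ?thesis by (simp add: inner_prod_def inner_axis)
    qed
    have off: "fst y $ g = 0 \<and> snd y $ g = 0" if g: "g \<notin> A" for g
    proof -
      \<comment> \<open>With this \<open>e\<close>, the set \<open>F e\<close> misses the receiver
        of \<open>g\<close>. Hence \<open>g\<close> does not enter \<open>F e\<close>, and its two
        coordinates can be moved separately.\<close>
      obtain e where e: "e \<in> A" "sender e = receiver g" using leaving by blast
      have "receiver g \<notin> F e" using F(2)[OF e(1) e(1)] e(2) by (simp add: enters_def)
      then have ng: "\<not> enters g (F e)" by (simp add: enters_def)
      have "y \<bullet> (axis g 1, 0) = 0"
        by (rule move[OF e(1)]) (use e g ng F(2) in \<open>auto simp: cell_def base_def axis_def\<close>)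
      moreover have "y \<bullet> (0, axis g 1) = 0"
        by (rule move[OF e(1)]) (use e g ng F(2) in \<open>auto simp: cell_def base_def axis_def\<close>)
      ultimately show ?thesis by (simp add: inner_prod_def inner_axis)
    qed
    \<comment> \<open>The left side is the same for all \<open>e\<close> in \<open>A\<close>, hence
      so is \<open>fst y $ e\<close>.\<close>
    have "y \<bullet> base e = (\<Sum>f\<in>A. fst y $ f) - fst y $ e" if "e \<in> A" for e
    proof -
      have "y \<bullet> base e = (\<Sum>f\<in>UNIV. if f \<in> A - {e} then fst y $ f else 0)"
        by (simp add: base_def inner_prod_def inner_vec_def if_distrib cong: if_cong)
      also have "\<dots> = sum (\<lambda>f. fst y $ f) (A - {e})"
        by (simp add: sum.If_cases set_diff_eq)
      also have "\<dots> = (\<Sum>f\<in>A. fst y $ f) - fst y $ e" using that by (simp add: sum_diff1)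
      finally show ?thesis .
    qed
    then have eq: "fst y $ e = fst y $ e0" if "e \<in> A" for e
      using base0[OF that] that e0 by simp
    \<comment> \<open>Now \<open>y\<close> is a multiple of \<open>game_vec A\<close> and also
      orthogonal to it.\<close>
    have "game_vec A \<bullet> y = (\<Sum>e\<in>A. 2 * fst y $ e0)"
      unfolding inner_game_vec using on eq by (intro sum.cong) auto
    then have "fst y $ e0 = 0" using vy e0 by auto
    then have "fst y $ e = 0 \<and> snd y $ e = 0" for e
      using on[of e] off[of e] eq[of e] by (cases "e \<in> A") auto
    then show "y = 0" by (simp add: prod_eq_iff vec_eq_iff)
  qed (simp_all add: polytope_bicausal_polytope inner_game_vec_le[OF cut])
qed

section \<open>Strong connectivity through cuts\<close>

text \<open>A path from outside \<open>F\<close> into \<open>F\<close> must cross by an entering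
  arc. Conversely, no arc enters the set of vertices unreachable from \<open>u\<close>. Stated for
  arbitrary pre-digraphs, to serve both for \<open>G\<close> and for \<open>G\<close> with an arc
  deleted.\<close>

lemma strongly_connected_UNIV_iff:
  fixes H :: "('a, 'b) pre_digraph"
  assumes "verts H = UNIV"
  shows "strongly_connected H \<longleftrightarrow>
    (\<forall>F\<in>proper_subsets. \<exists>a\<in>arcs H. tail H a \<notin> F \<and> head H a \<in> F)" (is "_ \<longleftrightarrow> ?cut")
proof -
  have reach: "u \<rightarrow>\<^sup>*\<^bsub>H\<^esub> v \<longleftrightarrow> (u, v) \<in> (arcs_ends H)\<^sup>*" for u v
    unfolding reachable_def assms
    by (auto intro: rtrancl_consistent_rtrancl_on rtrancl_on_rtranclI)
  have "strongly_connected H \<longleftrightarrow> (\<forall>u v. (u, v) \<in> (arcs_ends H)\<^sup>*)"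
    by (simp add: strongly_connected_def assms reach)
  also have "\<dots> \<longleftrightarrow> ?cut"
  proof safe
    fix F :: "'a set" assume all: "\<forall>u v. (u, v) \<in> (arcs_ends H)\<^sup>*" and "F \<in> proper_subsets"
    then obtain u v where "u \<notin> F" "v \<in> F" by (auto simp: proper_subsets_def)
    show "\<exists>a\<in>arcs H. tail H a \<notin> F \<and> head H a \<in> F"
    proof (rule ccontr)
      assume no: "\<not> ?thesis"
      have "(u, v) \<in> (arcs_ends H)\<^sup>*" using all by blast
      then have "v \<notin> F"
        by induction (use \<open>u \<notin> F\<close> no in \<open>auto simp: arcs_ends_conv\<close>)
      with \<open>v \<in> F\<close> show False by blast
    qed
  next
    fix u v assume cut: ?cut
    let ?F = "- {w. (u, w) \<in> (arcs_ends H)\<^sup>*}"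
    show "(u, v) \<in> (arcs_ends H)\<^sup>*"
    proof (rule ccontr)
      assume "(u, v) \<notin> (arcs_ends H)\<^sup>*"
      then have "?F \<in> proper_subsets" by (auto simp: proper_subsets_def)
      with cut obtain a where "a \<in> arcs H" "tail H a \<notin> ?F" "head H a \<in> ?F" by blast
      then show False
        by (auto simp: arcs_ends_conv dest: rtrancl_into_rtrancl)
    qed
  qed
  finally show ?thesis .
qed

section \<open>From minimally strong digraphs to link sets\<close>

theorem corollary3:
  fixes G :: "'n::card2 pair_pre_digraph"
  assumes "pverts G = UNIV" and "minimally_strong G"
  shows "(\<forall>P :: 'n correlation. agrees_with_bicausal_order P \<longrightarrow>
            win_prob G P \<le> 1 - 1 / (2 * real (card (parcs G)))) \<and>
         (\<exists>(v :: 'n corr_space) (c :: real).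
            (\<forall>P :: 'n correlation.
               win_prob G P - (1 - 1 / (2 * real (card (parcs G)))) = v \<bullet> corr_vec P - c) \<and>
            facet_defining (bicausal_polytope :: 'n corr_space set) v c)"
proof -
  define A where "A = Rep_link -` parcs G"
  interpret pair_digraph G
    using assms(2) by (simp add: minimally_strong_def)
  \<comment> \<open>Since \<open>G\<close> has no loops, every arc is represented by a link.\<close>
  have img: "Rep_link ` A = parcs G"
  proof (intro equalityI subsetI)
    fix x assume x: "x \<in> parcs G"
    then have "x \<in> {(s, r). s \<noteq> r}" using pair_no_loops[OF x] by (simp add: case_prod_beta)
    then have "Rep_link (Abs_link x) = x" by (rule Abs_link_inverse)
    with x show "x \<in> Rep_link ` A" by (metis A_def image_eqI vimageI)
  qed (auto simp: A_def)
  have inj: "inj_on Rep_link A" by (simp add: inj_on_def Rep_link_inject)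
  have card: "card (parcs G) = card A"
    using card_image[OF inj] img by simp
  have strong: "\<exists>e\<in>A. enters e F" if "F \<in> proper_subsets" for F
  proof -
    have "strongly_connected (with_proj G)" using assms(2) by (simp add: minimally_strong_def)
    then have "\<exists>a\<in>Rep_link ` A. fst a \<notin> F \<and> snd a \<in> F"
      using strongly_connected_UNIV_iff[of "with_proj G"] assms(1) that img by simp
    then show ?thesis by (auto simp: enters_def Rep_link_eq)
  qed
  have crit: "\<exists>F\<in>proper_subsets. \<forall>f\<in>A. enters f F \<longleftrightarrow> f = e" if "e \<in> A" for e
  proof -
    have "Rep_link e \<in> parcs G" using that by (simp add: A_def)
    then have "\<not> strongly_connected (pre_digraph.del_arc (with_proj G) (Rep_link e))"
      using assms(2) by (simp add: minimally_strong_def)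
    then obtain F where F: "F \<in> proper_subsets"
      "\<forall>a\<in>parcs G - {Rep_link e}. \<not> (fst a \<notin> F \<and> snd a \<in> F)"
      using strongly_connected_UNIV_iff[of "pre_digraph.del_arc (with_proj G) (Rep_link e)"] assms(1)
      by (auto simp: pre_digraph.del_arc_simps)
    \<comment> \<open>After deletion of \<open>e\<close> nothing enters \<open>F\<close>, while in
      \<open>G\<close> some arc does; that arc can only be \<open>e\<close>.\<close>
    have only: "f = e" if "f \<in> A" "enters f F" for f
      using F(2) that by (auto simp: A_def enters_def sender_def receiver_def Rep_link_inject)
    with strong[OF F(1)] have "\<forall>f\<in>A. enters f F \<longleftrightarrow> f = e" by blast
    with F(1) show ?thesis by blast
  qed
  have pos: "card A > 0"
    using strong[OF Compl_singleton_in_proper_subsets] by (auto simp: card_gt_0_iff)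
  define t where "t = 1 / (2 * real (card A))"
  \<comment> \<open>This holds for every correlation, bi-causal or not: the game inequality is
    \<open>t\<close> times the one for \<open>game_vec A\<close>.\<close>
  have win: "win_prob G P - (1 - 1 / (2 * real (card (parcs G)))) =
      t * (game_vec A \<bullet> corr_vec P - (real (card A) - 1))" for P :: "'n correlation"
  proof -
    have "(\<Sum>(i, j)\<in>parcs G. \<Sum>x\<in>UNIV. pmf (P i j x) x) =
        (\<Sum>e\<in>A. \<Sum>x\<in>UNIV. pmf (P (sender e) (receiver e) x) x)"
      unfolding img[symmetric] sum.reindex[OF inj] by (simp add: Rep_link_eq)
    also have "\<dots> = (\<Sum>e\<in>A. (fst (corr_vec P) $ e - snd (corr_vec P) $ e) + 1)"
      by (intro sum.cong) (auto simp: UNIV_bool corr_vec_def pmf_bool_True)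
    also have "\<dots> = game_vec A \<bullet> corr_vec P + real (card A)"
      by (simp add: inner_game_vec sum.distrib)
    finally have sum: "(\<Sum>(i, j)\<in>parcs G. \<Sum>x\<in>UNIV. pmf (P i j x) x) =
        game_vec A \<bullet> corr_vec P + real (card A)" .
    have "1 / (2 * k) * (g + k) - (1 - 1 / (2 * k)) = 1 / (2 * k) * (g - (k - 1))"
      if "k > 0" for g k :: real
      using that by (simp add: field_simps)
    from this[of "real (card A)"] show ?thesis
      using pos by (simp only: win_prob_def sum card t_def of_nat_0_less_iff)
  qed
  have "t > 0" using pos by (simp add: t_def)
  have "win_prob G P \<le> 1 - 1 / (2 * real (card (parcs G)))"
    if "agrees_with_bicausal_order P" for P
  proof -
    have "corr_vec P \<in> bicausal_polytope" using that by (auto simp: bicausal_polytope_def)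
    then have "game_vec A \<bullet> corr_vec P - (real (card A) - 1) \<le> 0"
      using inner_game_vec_le[OF strong] by simp
    then have "t * (game_vec A \<bullet> corr_vec P - (real (card A) - 1)) \<le> 0"
      using \<open>t > 0\<close> by (intro mult_nonneg_nonpos) auto
    with win[of P] show ?thesis by linarith
  qed
  moreover have "win_prob G P - (1 - 1 / (2 * real (card (parcs G)))) =
      (t *\<^sub>R game_vec A) \<bullet> corr_vec P - t * (real (card A) - 1)" for P
    by (simp add: win right_diff_distrib)
  ultimately show ?thesis
    using facet_defining_scaleR[OF facet_defining_game_vec[OF strong crit] \<open>t > 0\<close>] by blast
qed

end
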